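(* For every $n\ge 2$ there exist polynomials $p,q\in\mathbf{C}[x_1,\dots,x_n]$ such that the hypersurfaces $\{p=0\}$ and $\{q=0\}$ in $\mathbf{C}^n$ are isomorphic, but the number of zeros in $\mathbf{C}^n$ of $\mathrm{grad}(p)$ is different from the number of zeros in $\mathbf{C}^n$ of $\mathrm{grad}(q)$; in particular, although the fibers $\{p=0\}$ and $\{q=0\}$ are isomorphic, there is some $c\in\mathbf{C}$ for which the fibers $\{p=c\}$ and $\{q=c\}$ are not isomorphic.
   Context: For $p\in\mathbf{C}[x_1,\dots,x_n]$, $\mathrm{grad}(p)=\left(\frac{\partial p}{\partial x_1},\dots,\frac{\partial p}{\partial x_n}\right)$; the number of its zeros in $\mathbf{C}^n$ may be infinite. Hypersurfaces are considered as affine schemes: $\{p=c\}$ and $\{q=d\}$ are isomorphic if the $\mathbf{C}$-algebras $\mathbf{C}[x_1,\dots,x_n]/\langle p-c\rangle$ and $\mathbf{C}[x_1,\dots,x_n]/\langle q-d\rangle$ are isomorphic. *)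

theory Defs
  imports
    Complex_Main
    "HOL-Library.Poly_Mapping"
    "HOL-Library.Extended_Nat"
    "HOL-Library.FuncSet"
    "HOL-Algebra.QuotRing"
begin

text \<open>
  A polynomial maps each monomial, given by its finitely supported exponent function, to its
  coefficient. The variables are indexed from \<open>0\<close>, and the polynomials in \<open>n\<close> variables are
  those in which only the indices below \<open>n\<close> occur.
\<close>

type_synonym cpoly = "(nat \<Rightarrow>\<^sub>0 nat) \<Rightarrow>\<^sub>0 complex"

definition cpolys :: "nat \<Rightarrow> cpoly set" where
  "cpolys n = {p. \<forall>m \<in> Poly_Mapping.keys p. Poly_Mapping.keys m \<subseteq> {..<n}}"

definition cpoly_const :: "complex \<Rightarrow> cpoly" where
  "cpoly_const c = Poly_Mapping.single 0 c"

definition cpoly_ring :: "nat \<Rightarrow> cpoly ring" where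
  "cpoly_ring n = \<lparr>carrier = cpolys n, mult = (*), one = 1, zero = 0, add = (+)\<rparr>"

definition cpoly_eval :: "(nat \<Rightarrow> complex) \<Rightarrow> cpoly \<Rightarrow> complex" where
  "cpoly_eval x p =
    (\<Sum>m \<in> Poly_Mapping.keys p. Poly_Mapping.lookup p m *
      (\<Prod>i \<in> Poly_Mapping.keys m. x i ^ Poly_Mapping.lookup m i))"

text \<open>
  The truncated subtraction of exponents is harmless: where it truncates, the coefficient is \<open>0\<close>.
\<close>

definition cpoly_pderiv :: "nat \<Rightarrow> cpoly \<Rightarrow> cpoly" where
  "cpoly_pderiv i p =
    (\<Sum>m \<in> Poly_Mapping.keys p.
      Poly_Mapping.single (m - Poly_Mapping.single i 1)
        (of_nat (Poly_Mapping.lookup m i) * Poly_Mapping.lookup p m))"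

text \<open>Extensional functions make each point of \<open>\<complex>\<^sup>n\<close> be represented exactly once.\<close>

definition affine_space :: "nat \<Rightarrow> (nat \<Rightarrow> complex) set" where
  "affine_space n = {..<n} \<rightarrow>\<^sub>E UNIV"

definition grad_zeros :: "nat \<Rightarrow> cpoly \<Rightarrow> (nat \<Rightarrow> complex) set" where
  "grad_zeros n p = {x \<in> affine_space n. \<forall>i<n. cpoly_eval x (cpoly_pderiv i p) = 0}"

definition num_elems :: "'a set \<Rightarrow> enat" where
  "num_elems A = (if finite A then enat (card A) else \<infinity>)"

definition fiber_ideal :: "nat \<Rightarrow> cpoly \<Rightarrow> complex \<Rightarrow> cpoly set" where
  "fiber_ideal n p c = Idl\<^bsub>cpoly_ring n\<^esub> {p - cpoly_const c}"

definition fiber_ring :: "nat \<Rightarrow> cpoly \<Rightarrow> complex \<Rightarrow> cpoly set ring" where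
  "fiber_ring n p c = cpoly_ring n Quot fiber_ideal n p c"

definition fiber_scalar :: "nat \<Rightarrow> cpoly \<Rightarrow> complex \<Rightarrow> complex \<Rightarrow> cpoly set" where
  "fiber_scalar n p c a = fiber_ideal n p c +>\<^bsub>cpoly_ring n\<^esub> cpoly_const a"

text \<open>
  A ring isomorphism is an isomorphism of \<open>\<complex>\<close>-algebras iff it respects the structure maps from \<open>\<complex>\<close>.
\<close>

definition fibers_isomorphic :: "nat \<Rightarrow> cpoly \<Rightarrow> complex \<Rightarrow> cpoly \<Rightarrow> complex \<Rightarrow> bool" where
  "fibers_isomorphic n p c q d \<longleftrightarrow>
    (\<exists>h \<in> ring_iso (fiber_ring n p c) (fiber_ring n q d).
      \<forall>a. h (fiber_scalar n p c a) = fiber_scalar n q d a)"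

end

theory Submission
  imports Defs
begin

text \<open>
  Write \<open>x\<close> and \<open>y\<close> for the first two variables and take \<open>p = xy - 1\<close> and \<open>q = x\<^sup>2y + x - 1\<close>,
  regarded as polynomials in \<open>n\<close> variables. On both zero fibres \<open>x\<close> is invertible, with inverse \<open>y\<close>
  for \<open>p\<close> and \<open>xy + 1\<close> for \<open>q\<close>, and the equation determines \<open>y\<close> from \<open>x\<close>. Both coordinate rings are
  therefore \<open>\<complex>[x, 1/x]\<close> with the remaining variables adjoined, and the two hypersurfaces are two
  embeddings of the same variety. The isomorphism comes from the substitution
  \<open>y \<mapsto> xy + 1\<close>, which maps \<open>p\<close> to \<open>q\<close>, and its inverse from \<open>y \<mapsto> (1 - x)y\<^sup>2\<close>
  (\<open>zero_fibers_isomorphic\<close>).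

  The gradients see the embedding: that of \<open>p\<close> begins with \<open>(y, x)\<close> and vanishes at the origin,
  while that of \<open>q\<close> begins with \<open>(2xy + 1, x\<^sup>2)\<close> and vanishes nowhere.

  The fibres over \<open>-1\<close> are told apart by connectedness. The fibre \<open>xy = 0\<close> consists of two
  hyperplanes that meet, so its coordinate ring has only the idempotents \<open>0\<close> and \<open>1\<close>
  (\<open>idempotent_mod_var_mult_var\<close>). The fibre \<open>x(xy + 1) = 0\<close> is a disjoint union, and \<open>xy + 1\<close> is
  the idempotent that is \<open>1\<close> on one part and \<open>0\<close> on the other.

  Membership in the ideals of the fibres is expressed by divisibility in the ring of polynomials in
  all variables (\<open>fiber_ideal_eq\<close>), so that the computations do not mention the carrier sets.
\<close>

section \<open>Substitution homomorphisms\<close>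

definition cpoly_var :: "nat \<Rightarrow> cpoly" where
  "cpoly_var i = Poly_Mapping.single (Poly_Mapping.single i 1) 1"

definition monom_subst :: "(nat \<Rightarrow> cpoly) \<Rightarrow> (nat \<Rightarrow>\<^sub>0 nat) \<Rightarrow> cpoly" where
  "monom_subst s m = (\<Prod>i\<in>Poly_Mapping.keys m. s i ^ Poly_Mapping.lookup m i)"

definition cpoly_subst :: "(nat \<Rightarrow> cpoly) \<Rightarrow> cpoly \<Rightarrow> cpoly" where
  "cpoly_subst s p =
    (\<Sum>m\<in>Poly_Mapping.keys p. cpoly_const (Poly_Mapping.lookup p m) * monom_subst s m)"

lemma cpoly_const_0 [simp]: "cpoly_const 0 = 0"
  and cpoly_const_1 [simp]: "cpoly_const 1 = 1"
  and cpoly_const_add: "cpoly_const (a + b) = cpoly_const a + cpoly_const b"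
  and cpoly_const_mult: "cpoly_const (a * b) = cpoly_const a * cpoly_const b"
  by (auto simp: cpoly_const_def single_add mult_single single_one)

lemma cpoly_const_inject: "cpoly_const a = cpoly_const b \<longleftrightarrow> a = b"
  unfolding cpoly_const_def by (metis lookup_single_eq)

lemma cpoly_const_minus: "cpoly_const (- a) = - cpoly_const a"
  by (simp add: cpoly_const_def single_uminus)

lemma sum_keys_single:
  assumes "f m 0 = 0"
  shows "(\<Sum>k\<in>Poly_Mapping.keys (Poly_Mapping.single m c).
           f k (Poly_Mapping.lookup (Poly_Mapping.single m c) k)) = f m c"
  using assms by (cases "c = 0") simp_all

lemma cpoly_eq_sum_single:
  "(\<Sum>m\<in>Poly_Mapping.keys p. Poly_Mapping.single m (Poly_Mapping.lookup p m)) = (p :: cpoly)"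
  by (rule poly_mapping_eqI)
     (auto simp: lookup_sum lookup_single when_def in_keys_iff sum.delta)

lemma cpoly_induct [case_names single add]:
  assumes "\<And>m c. P (Poly_Mapping.single m c)" and "\<And>p q. P p \<Longrightarrow> P q \<Longrightarrow> P (p + q)"
  shows "P (p :: cpoly)"
proof -
  have "P (\<Sum>m\<in>A. Poly_Mapping.single m (Poly_Mapping.lookup p m))" if "finite A" for A
    using that
  proof (induction A)
    case empty
    then show ?case using assms(1)[of 0 0] by simp
  qed (simp add: assms)
  from this[of "Poly_Mapping.keys p"] show ?thesis by (simp add: cpoly_eq_sum_single)
qed

lemma monom_subst_0 [simp]: "monom_subst s 0 = 1"
  by (simp add: monom_subst_def)

lemma monom_subst_superset:
  assumes "finite A" "Poly_Mapping.keys m \<subseteq> A"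
  shows "monom_subst s m = (\<Prod>i\<in>A. s i ^ Poly_Mapping.lookup m i)"
  unfolding monom_subst_def
  by (rule prod.mono_neutral_left) (use assms in \<open>auto simp: in_keys_iff\<close>)

lemma monom_subst_add: "monom_subst s (m + m') = monom_subst s m * monom_subst s m'"
proof -
  let ?A = "Poly_Mapping.keys m \<union> Poly_Mapping.keys m'"
  have "Poly_Mapping.keys (m + m') \<subseteq> ?A" by (rule keys_add)
  then show ?thesis
    by (simp add: monom_subst_superset[of ?A] lookup_add power_add prod.distrib)
qed

lemma cpoly_subst_single: "cpoly_subst s (Poly_Mapping.single m c) = cpoly_const c * monom_subst s m"
  unfolding cpoly_subst_def
  by (rule sum_keys_single[where f = "\<lambda>m c. cpoly_const c * monom_subst s m"]) simp

lemma cpoly_subst_add: "cpoly_subst s (p + q) = cpoly_subst s p + cpoly_subst s q"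
  unfolding cpoly_subst_def
  by (rule setsum_keys_plus_distrib) (simp_all add: cpoly_const_add distrib_right)

lemma cpoly_subst_0 [simp]: "cpoly_subst s 0 = 0"
  by (simp add: cpoly_subst_def)

lemma cpoly_subst_minus: "cpoly_subst s (- p) = - cpoly_subst s p"
  using cpoly_subst_add[of s p "- p"] by (simp add: eq_neg_iff_add_eq_0 add.commute)

lemma cpoly_subst_diff: "cpoly_subst s (p - q) = cpoly_subst s p - cpoly_subst s q"
  using cpoly_subst_add[of s p "- q"] by (simp add: cpoly_subst_minus)

lemma cpoly_subst_const [simp]: "cpoly_subst s (cpoly_const c) = cpoly_const c"
  by (simp add: cpoly_subst_single cpoly_const_def[of c])

lemma cpoly_subst_1 [simp]: "cpoly_subst s 1 = 1"
  using cpoly_subst_const[of s 1] by simp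

lemma cpoly_subst_var [simp]: "cpoly_subst s (cpoly_var i) = s i"
  by (simp add: cpoly_var_def cpoly_subst_single monom_subst_def)

lemma cpoly_subst_mult: "cpoly_subst s (p * q) = cpoly_subst s p * cpoly_subst s q"
proof (induction p rule: cpoly_induct)
  case (single m c)
  show ?case
  proof (induction q rule: cpoly_induct)
    case (single m' c')
    then show ?case
      by (simp add: mult_single cpoly_subst_single monom_subst_add cpoly_const_mult mult_ac)
  qed (simp add: distrib_left cpoly_subst_add)
qed (simp add: distrib_right cpoly_subst_add)

lemma cpoly_subst_power: "cpoly_subst s (p ^ k) = cpoly_subst s p ^ k"
  by (induction k) (simp_all add: cpoly_subst_mult)

lemmas cpoly_subst_simps =
  cpoly_subst_add cpoly_subst_diff cpoly_subst_minus cpoly_subst_mult cpoly_subst_power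

lemma cpoly_subst_subst:
  "cpoly_subst t (cpoly_subst s p) = cpoly_subst (\<lambda>i. cpoly_subst t (s i)) p"
proof -
  have prod: "cpoly_subst t (\<Prod>i\<in>A. s i ^ k i) = (\<Prod>i\<in>A. cpoly_subst t (s i) ^ k i)"
    for A and k :: "nat \<Rightarrow> nat"
    by (induction A rule: infinite_finite_induct) (simp_all add: cpoly_subst_simps)
  show ?thesis
    by (induction p rule: cpoly_induct)
       (simp_all add: cpoly_subst_single cpoly_subst_simps monom_subst_def prod)
qed

lemma var_power: "cpoly_var i ^ k = Poly_Mapping.single (Poly_Mapping.single i k) 1"
  by (induction k) (simp_all add: cpoly_var_def mult_single flip: single_add)

lemma cpoly_var_neq_0: "cpoly_var i \<noteq> 0"
  unfolding cpoly_var_def by (metis lookup_single_eq lookup_zero zero_neq_one)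

lemma monom_subst_var: "monom_subst cpoly_var m = Poly_Mapping.single m 1"
proof -
  have "(\<Prod>i\<in>A. cpoly_var i ^ Poly_Mapping.lookup m i) =
      Poly_Mapping.single (\<Sum>i\<in>A. Poly_Mapping.single i (Poly_Mapping.lookup m i)) 1"
    if "finite A" for A
    using that by induction (simp_all add: var_power mult_single)
  moreover have "(\<Sum>i\<in>Poly_Mapping.keys m. Poly_Mapping.single i (Poly_Mapping.lookup m i)) = m"
    by (rule poly_mapping_eqI)
       (auto simp: lookup_sum lookup_single when_def in_keys_iff sum.delta)
  ultimately show ?thesis by (simp add: monom_subst_def)
qed

lemma cpoly_subst_ident [simp]: "cpoly_subst cpoly_var p = p"
  by (induction p rule: cpoly_induct)
     (simp_all add: cpoly_subst_single cpoly_subst_add monom_subst_var cpoly_const_def mult_single)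

lemma dvd_power_diff:
  fixes a b d :: "'a :: comm_ring_1"
  assumes "d dvd a - b"
  shows "d dvd a ^ k - b ^ k"
  using assms by (metis dvd_mult2 power_diff_sumr2)

lemma dvd_prod_diff:
  fixes d :: "'a :: comm_ring_1"
  assumes "\<And>i. i \<in> A \<Longrightarrow> d dvd f i - g i"
  shows "d dvd prod f A - prod g A"
  using assms
proof (induction A rule: infinite_finite_induct)
  case (insert i A)
  have eq: "prod f (insert i A) - prod g (insert i A) =
      f i * (prod f A - prod g A) + (f i - g i) * prod g A"
    using insert.hyps by (simp add: algebra_simps)
  show ?case unfolding eq using insert by (intro dvd_add) (simp_all add: dvd_mult dvd_mult2)
qed simp_all

text \<open>
  Polynomials respect congruences. The instance in which one of the substitutions is the identity
  shows that two substitutions are mutually inverse modulo \<open>d\<close> once this is known on variables.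
\<close>

lemma cpoly_subst_cong_dvd:
  assumes "\<And>m i. m \<in> Poly_Mapping.keys p \<Longrightarrow> i \<in> Poly_Mapping.keys m \<Longrightarrow> d dvd s i - t i"
  shows "d dvd cpoly_subst s p - cpoly_subst t p"
  unfolding cpoly_subst_def sum_subtractf[symmetric] right_diff_distrib[symmetric] monom_subst_def
  by (intro dvd_sum dvd_mult dvd_prod_diff dvd_power_diff assms)

section \<open>Polynomials in the first \<open>n\<close> variables\<close>

lemma cpolys_add: "p \<in> cpolys n \<Longrightarrow> q \<in> cpolys n \<Longrightarrow> p + q \<in> cpolys n"
  unfolding cpolys_def using keys_add[of p q] by blast

lemma cpolys_minus: "p \<in> cpolys n \<Longrightarrow> - p \<in> cpolys n"
  unfolding cpolys_def by (simp add: in_keys_iff)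

lemma cpolys_diff: "p \<in> cpolys n \<Longrightarrow> q \<in> cpolys n \<Longrightarrow> p - q \<in> cpolys n"
  using cpolys_add[of p n "- q"] cpolys_minus[of q n] by simp

lemma cpolys_mult: "p \<in> cpolys n \<Longrightarrow> q \<in> cpolys n \<Longrightarrow> p * q \<in> cpolys n"
proof -
  assume pq: "p \<in> cpolys n" "q \<in> cpolys n"
  have "Poly_Mapping.keys m \<subseteq> {..<n}" if m: "m \<in> Poly_Mapping.keys (p * q)" for m
  proof -
    obtain a b where "m = a + b" "a \<in> Poly_Mapping.keys p" "b \<in> Poly_Mapping.keys q"
      using m keys_mult[of p q] by blast
    with pq keys_add[of a b] show ?thesis by (fastforce simp: cpolys_def)
  qed
  then show ?thesis by (simp add: cpolys_def)
qed

lemma cpolys_const: "cpoly_const c \<in> cpolys n"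
  by (simp add: cpolys_def cpoly_const_def)

lemma cpolys_0: "0 \<in> cpolys n" and cpolys_1: "1 \<in> cpolys n"
  using cpolys_const[of 0 n] cpolys_const[of 1 n] by simp_all

lemma cpolys_var: "i < n \<Longrightarrow> cpoly_var i \<in> cpolys n"
  by (simp add: cpolys_def cpoly_var_def)

lemma cpolys_power: "p \<in> cpolys n \<Longrightarrow> p ^ k \<in> cpolys n"
  by (induction k) (simp_all add: cpolys_1 cpolys_mult)

lemmas cpolys_intros = cpolys_add cpolys_diff cpolys_minus cpolys_mult cpolys_power cpolys_const
  cpolys_0 cpolys_1 cpolys_var

lemma cpolys_subst:
  assumes "\<And>i. i \<in> I \<Longrightarrow> s i \<in> cpolys n"
    and "\<And>m. m \<in> Poly_Mapping.keys p \<Longrightarrow> Poly_Mapping.keys m \<subseteq> I"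
  shows "cpoly_subst s p \<in> cpolys n"
proof -
  have "monom_subst s m \<in> cpolys n" if "Poly_Mapping.keys m \<subseteq> I" for m
  proof -
    have "(\<Prod>i\<in>A. s i ^ Poly_Mapping.lookup m i) \<in> cpolys n" if "finite A" "A \<subseteq> I" for A
      using that by induction (simp_all add: cpolys_intros assms)
    then show ?thesis using that by (simp add: monom_subst_def)
  qed
  then have summand: "cpoly_const (Poly_Mapping.lookup p m) * monom_subst s m \<in> cpolys n"
    if "m \<in> Poly_Mapping.keys p" for m
    using that assms(2) by (simp add: cpolys_intros)
  have "(\<Sum>m\<in>A. cpoly_const (Poly_Mapping.lookup p m) * monom_subst s m) \<in> cpolys n"
    if "finite A" "A \<subseteq> Poly_Mapping.keys p" for A
    using that by induction (simp_all add: cpolys_intros summand)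
  then show ?thesis by (simp add: cpoly_subst_def)
qed

lemma cpolys_subst_cpolys: "f \<in> cpolys n \<Longrightarrow> (\<And>i. i < n \<Longrightarrow> s i \<in> cpolys k) \<Longrightarrow> cpoly_subst s f \<in> cpolys k"
  by (rule cpolys_subst[of "{..<n}"]) (auto simp: cpolys_def)

lemma cpoly_subst_cong_dvd_cpolys:
  assumes "f \<in> cpolys n" "\<And>i. i < n \<Longrightarrow> d dvd s i - t i"
  shows "d dvd cpoly_subst s f - cpoly_subst t f"
  by (rule cpoly_subst_cong_dvd) (use assms in \<open>auto simp: cpolys_def\<close>)

text \<open>
  Setting the variables from \<open>n\<close> on to zero is a ring retraction onto the polynomials in the first
  \<open>n\<close> variables, and it moves any cofactor into that subring.
\<close>

lemma dvd_in_cpolys: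
  assumes "d \<in> cpolys n" "f \<in> cpolys n" "d dvd f"
  shows "\<exists>g\<in>cpolys n. f = d * g"
proof -
  obtain g where g: "f = d * g" using assms(3) by blast
  let ?r = "cpoly_subst (\<lambda>i. if i < n then cpoly_var i else 0)"
  have r: "?r h = h" if "h \<in> cpolys n" for h
    using cpoly_subst_cong_dvd_cpolys[OF that, of 0 "\<lambda>i. if i < n then cpoly_var i else 0" cpoly_var]
    by simp
  have "f = d * ?r g" using r[OF assms(2)] unfolding g cpoly_subst_mult r[OF assms(1)] by (rule sym)
  moreover have "?r g \<in> cpolys n" by (rule cpolys_subst[of UNIV]) (auto simp: cpolys_intros)
  ultimately show ?thesis by blast
qed

section \<open>Fibre rings\<close>

lemma cpoly_ring_simps [simp]:
  "carrier (cpoly_ring n) = cpolys n" "mult (cpoly_ring n) = (*)" "one (cpoly_ring n) = 1"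
  "zero (cpoly_ring n) = 0" "add (cpoly_ring n) = (+)"
  by (simp_all add: cpoly_ring_def)

lemma cring_cpoly_ring: "cring (cpoly_ring n)"
proof (rule cringI)
  show "abelian_group (cpoly_ring n)"
  proof (rule abelian_groupI)
    fix x assume "x \<in> carrier (cpoly_ring n)"
    then show "\<exists>y\<in>carrier (cpoly_ring n). y \<oplus>\<^bsub>cpoly_ring n\<^esub> x = \<zero>\<^bsub>cpoly_ring n\<^esub>"
      by (intro bexI[of _ "- x"]) (simp_all add: cpolys_intros)
  qed (simp_all add: cpolys_intros add_ac)
  show "Group.comm_monoid (cpoly_ring n)"
    by (rule comm_monoidI) (simp_all add: cpolys_intros mult_ac)
qed (simp add: distrib_right)

lemma fiber_ideal_eq:
  assumes "p \<in> cpolys n"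
  shows "fiber_ideal n p c = {f \<in> cpolys n. p - cpoly_const c dvd f}"
proof -
  interpret R: cring "cpoly_ring n" by (rule cring_cpoly_ring)
  have d: "p - cpoly_const c \<in> cpolys n" using assms by (intro cpolys_intros)
  have "fiber_ideal n p c = PIdl\<^bsub>cpoly_ring n\<^esub> (p - cpoly_const c)"
    unfolding fiber_ideal_def using d by (intro R.cgenideal_eq_genideal[symmetric]) simp
  also have "\<dots> = {g * (p - cpoly_const c) |g. g \<in> cpolys n}"
    by (simp add: cgenideal_def)
  also have "\<dots> = {f \<in> cpolys n. p - cpoly_const c dvd f}"
    using d dvd_in_cpolys[OF d] by (fastforce simp: mult.commute intro: cpolys_intros)
  finally show ?thesis .
qed

lemma ideal_fiber_ideal: "p \<in> cpolys n \<Longrightarrow> ideal (fiber_ideal n p c) (cpoly_ring n)"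
  unfolding fiber_ideal_def
  by (rule ring.genideal_ideal) (auto intro: cring.axioms cring_cpoly_ring cpolys_intros)

definition fiber_coset :: "nat \<Rightarrow> cpoly \<Rightarrow> complex \<Rightarrow> cpoly \<Rightarrow> cpoly set" where
  "fiber_coset n p c f = fiber_ideal n p c +>\<^bsub>cpoly_ring n\<^esub> f"

lemma fiber_coset_eq:
  assumes "p \<in> cpolys n" "f \<in> cpolys n"
  shows "fiber_coset n p c f = {g \<in> cpolys n. p - cpoly_const c dvd g - f}"
proof -
  have "fiber_coset n p c f = (\<lambda>g. g + f) ` {g \<in> cpolys n. p - cpoly_const c dvd g}"
    using assms by (auto simp: fiber_coset_def a_r_coset_def' fiber_ideal_eq)
  also have "\<dots> = {g \<in> cpolys n. p - cpoly_const c dvd g - f}"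
  proof (intro equalityI subsetI)
    fix g assume "g \<in> {g \<in> cpolys n. p - cpoly_const c dvd g - f}"
    then show "g \<in> (\<lambda>g. g + f) ` {g \<in> cpolys n. p - cpoly_const c dvd g}"
      using assms by (intro image_eqI[of _ _ "g - f"]) (auto intro: cpolys_intros)
  qed (use assms in \<open>auto intro: cpolys_intros\<close>)
  finally show ?thesis .
qed

lemma fiber_coset_eq_iff:
  assumes "p \<in> cpolys n" "f \<in> cpolys n" "g \<in> cpolys n"
  shows "fiber_coset n p c f = fiber_coset n p c g \<longleftrightarrow> p - cpoly_const c dvd f - g"
proof
  assume "fiber_coset n p c f = fiber_coset n p c g"
  moreover have "f \<in> fiber_coset n p c f" using assms by (simp add: fiber_coset_eq)
  ultimately show "p - cpoly_const c dvd f - g" using assms by (simp add: fiber_coset_eq)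
next
  assume *: "p - cpoly_const c dvd f - g"
  have "p - cpoly_const c dvd h - f \<longleftrightarrow> p - cpoly_const c dvd h - g" for h
    using dvd_add_right_iff[OF *, of "h - f"] by simp
  then show "fiber_coset n p c f = fiber_coset n p c g" using assms by (simp add: fiber_coset_eq)
qed

lemma fiber_coset_hom:
  assumes "p \<in> cpolys n"
  shows "ring_hom_ring (cpoly_ring n) (fiber_ring n p c) (fiber_coset n p c)"
  using ideal.rcos_ring_hom_ring[OF ideal_fiber_ideal[OF assms]]
  unfolding fiber_ring_def fiber_coset_def[abs_def] .

lemma carrier_fiber_ring: "carrier (fiber_ring n p c) = fiber_coset n p c ` cpolys n"
  by (auto simp: fiber_ring_def FactRing_def A_RCOSETS_def' fiber_coset_def)

lemma fiber_scalar_eq: "fiber_scalar n p c a = fiber_coset n p c (cpoly_const a)"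
  by (simp add: fiber_scalar_def fiber_coset_def)

text \<open>
  Substitutions that carry each equation into the ideal of the other and are mutually inverse
  modulo these ideals induce an isomorphism. The second substitution identifies the kernel of the
  map \<open>h\<close> into the quotient and shows that \<open>h\<close> is surjective, so that the first isomorphism theorem
  applies.
\<close>

lemma fibers_isomorphicI:
  assumes p: "p \<in> cpolys n" and q: "q \<in> cpolys n"
    and s: "\<And>i. i < n \<Longrightarrow> s i \<in> cpolys n" and t: "\<And>i. i < n \<Longrightarrow> t i \<in> cpolys n"
    and sp: "q - cpoly_const d dvd cpoly_subst s (p - cpoly_const c)"
    and tq: "p - cpoly_const c dvd cpoly_subst t (q - cpoly_const d)"
    and ts: "\<And>i. i < n \<Longrightarrow> p - cpoly_const c dvd cpoly_subst t (s i) - cpoly_var i"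
    and st: "\<And>i. i < n \<Longrightarrow> q - cpoly_const d dvd cpoly_subst s (t i) - cpoly_var i"
  shows "fibers_isomorphic n p c q d"
proof -
  let ?P = "p - cpoly_const c" and ?Q = "q - cpoly_const d"
  let ?R = "cpoly_ring n" and ?S = "fiber_ring n q d"
  define h where "h f = fiber_coset n q d (cpoly_subst s f)" for f
  interpret S: ring_hom_ring ?R ?S "fiber_coset n q d" by (rule fiber_coset_hom[OF q])
  have sc: "cpoly_subst s f \<in> cpolys n" if "f \<in> cpolys n" for f
    using that s by (rule cpolys_subst_cpolys)
  have tc: "cpoly_subst t f \<in> cpolys n" if "f \<in> cpolys n" for f
    using that t by (rule cpolys_subst_cpolys)
  have tsf: "?P dvd cpoly_subst t (cpoly_subst s f) - f" if "f \<in> cpolys n" for f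
    using cpoly_subst_cong_dvd_cpolys[OF that, of ?P "\<lambda>i. cpoly_subst t (s i)" cpoly_var] ts
    by (simp add: cpoly_subst_subst)
  have stf: "?Q dvd cpoly_subst s (cpoly_subst t f) - f" if "f \<in> cpolys n" for f
    using cpoly_subst_cong_dvd_cpolys[OF that, of ?Q "\<lambda>i. cpoly_subst s (t i)" cpoly_var] st
    by (simp add: cpoly_subst_subst)
  have mono: "a dvd b \<Longrightarrow> cpoly_subst u a dvd cpoly_subst u b" for u a b
    by (auto simp: cpoly_subst_mult elim!: dvdE)
  have hom: "ring_hom_ring ?R ?S h"
  proof (rule ring_hom_ringI)
    show "ring ?R" "ring ?S" by (rule S.R.ring_axioms S.S.ring_axioms)+
    show "h x \<in> carrier ?S" if "x \<in> carrier ?R" for x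
      using that sc S.hom_closed by (simp add: h_def)
    show "h (x \<otimes>\<^bsub>?R\<^esub> y) = h x \<otimes>\<^bsub>?S\<^esub> h y" if "x \<in> carrier ?R" "y \<in> carrier ?R" for x y
      using that sc S.hom_mult[of "cpoly_subst s x" "cpoly_subst s y"]
      by (simp add: h_def cpoly_subst_mult)
    show "h (x \<oplus>\<^bsub>?R\<^esub> y) = h x \<oplus>\<^bsub>?S\<^esub> h y" if "x \<in> carrier ?R" "y \<in> carrier ?R" for x y
      using that sc S.hom_add[of "cpoly_subst s x" "cpoly_subst s y"]
      by (simp add: h_def cpoly_subst_add)
    show "h \<one>\<^bsub>?R\<^esub> = \<one>\<^bsub>?S\<^esub>" using S.hom_one by (simp add: h_def)
  qed
  interpret H: ring_hom_ring ?R ?S h by (rule hom)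
  have zero: "\<zero>\<^bsub>?S\<^esub> = fiber_coset n q d 0" using S.hom_zero by simp
  have ker_iff: "?Q dvd cpoly_subst s f \<longleftrightarrow> ?P dvd f" if f: "f \<in> cpolys n" for f
  proof
    assume "?Q dvd cpoly_subst s f"
    then have "?P dvd cpoly_subst t (cpoly_subst s f)" by (rule mono[THEN dvd_trans[OF tq]])
    then have "?P dvd cpoly_subst t (cpoly_subst s f) - (cpoly_subst t (cpoly_subst s f) - f)"
      using tsf[OF f] by (rule dvd_diff)
    then show "?P dvd f" by simp
  next
    assume "?P dvd f"
    then show "?Q dvd cpoly_subst s f" by (rule mono[THEN dvd_trans[OF sp]])
  qed
  have kernel: "a_kernel ?R ?S h = fiber_ideal n p c"
  proof -
    have "h f = \<zero>\<^bsub>?S\<^esub> \<longleftrightarrow> ?P dvd f" if f: "f \<in> cpolys n" for f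
      unfolding zero h_def ker_iff[OF f, symmetric]
      using fiber_coset_eq_iff[OF q sc[OF f] cpolys_0, of d] by (simp only: diff_0_right)
    then show ?thesis unfolding a_kernel_def' fiber_ideal_eq[OF p] cpoly_ring_simps by blast
  qed
  have surj: "h ` carrier ?R = carrier ?S"
  proof
    show "h ` carrier ?R \<subseteq> carrier ?S" using H.hom_closed by blast
    show "carrier ?S \<subseteq> h ` carrier ?R"
    proof
      fix y assume "y \<in> carrier ?S"
      then obtain g where g: "g \<in> cpolys n" "y = fiber_coset n q d g"
        by (auto simp: carrier_fiber_ring)
      have "h (cpoly_subst t g) = y"
        using stf[OF g(1)] fiber_coset_eq_iff[OF q sc[OF tc[OF g(1)]] g(1)]
        unfolding h_def g(2) by blast
      then show "y \<in> h ` carrier ?R" using tc[OF g(1)] by (metis cpoly_ring_simps(1) imageI)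
    qed
  qed
  have "(\<lambda>X. the_elem (h ` X)) \<in> ring_iso (fiber_ring n p c) ?S"
    using H.FactRing_iso_set[OF surj] unfolding kernel fiber_ring_def[of n p c] .
  moreover have "the_elem (h ` fiber_scalar n p c a) = fiber_scalar n q d a" for a
  proof -
    have "the_elem (h ` (a_kernel ?R ?S h +>\<^bsub>?R\<^esub> cpoly_const a)) = h (cpoly_const a)"
      by (rule H.the_elem_simp) (simp only: cpoly_ring_simps cpolys_const)
    moreover have "h (cpoly_const a) = fiber_scalar n q d a"
      by (simp only: h_def cpoly_subst_const fiber_scalar_eq)
    ultimately show ?thesis unfolding kernel fiber_scalar_def[of n p] by (rule trans)
  qed
  ultimately show ?thesis
    unfolding fibers_isomorphic_def by (intro bexI[where x = "\<lambda>X. the_elem (h ` X)"] allI)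
qed

lemma var_dvd_iff: "cpoly_var i dvd f \<longleftrightarrow> cpoly_subst (cpoly_var(i := 0)) f = 0"
proof
  assume "cpoly_var i dvd f"
  then show "cpoly_subst (cpoly_var(i := 0)) f = 0" by (auto simp: cpoly_subst_mult elim!: dvdE)
next
  assume *: "cpoly_subst (cpoly_var(i := 0)) f = 0"
  have "cpoly_var i dvd cpoly_subst cpoly_var f - cpoly_subst (cpoly_var(i := 0)) f"
    by (rule cpoly_subst_cong_dvd) auto
  with * show "cpoly_var i dvd f" by simp
qed

section \<open>Idempotents of the fibre rings\<close>

text \<open>
  Divisibility by a variable is the vanishing of a homomorphism into a domain, hence variables are
  prime.
\<close>

lemma var_dvd_mult_iff: "cpoly_var i dvd f * g \<longleftrightarrow> cpoly_var i dvd f \<or> cpoly_var i dvd g"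
  by (simp add: var_dvd_iff cpoly_subst_mult)

lemma var_mult_var_dvd:
  assumes "i \<noteq> j" "cpoly_var i dvd f" "cpoly_var j dvd f"
  shows "cpoly_var i * cpoly_var j dvd f"
proof -
  obtain g where g: "f = cpoly_var i * g" using assms(2) by blast
  have "\<not> cpoly_var j dvd cpoly_var i"
    using assms(1) by (simp add: var_dvd_iff cpoly_var_neq_0)
  with assms(3) g have "cpoly_var j dvd g" by (simp add: var_dvd_mult_iff)
  then show ?thesis by (simp add: g)
qed

text \<open>
  On each of the two hyperplanes an idempotent is \<open>0\<close> or \<open>1\<close>, since the coordinate ring there is a
  domain. The two values agree because both hyperplanes contain the origin.
\<close>

lemma idempotent_mod_var_mult_var:
  assumes "i \<noteq> j" and dvd: "cpoly_var i * cpoly_var j dvd f * (f - 1)"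
  shows "cpoly_var i * cpoly_var j dvd f \<or> cpoly_var i * cpoly_var j dvd f - 1"
proof -
  have not_both: "\<not> (cpoly_var k dvd f \<and> cpoly_var l dvd f - 1)" for k l
  proof
    assume "cpoly_var k dvd f \<and> cpoly_var l dvd f - 1"
    then have "cpoly_subst (\<lambda>_. 0) f = 0" "cpoly_subst (\<lambda>_. 0) (f - 1) = 0"
      by (auto simp: cpoly_subst_mult elim!: dvdE)
    then show False by (simp add: cpoly_subst_diff)
  qed
  have "cpoly_var i dvd f * (f - 1)" "cpoly_var j dvd f * (f - 1)"
    using dvd by (auto intro: dvd_mult_left dvd_mult_right)
  with not_both show ?thesis
    using var_mult_var_dvd[OF assms(1)] by (auto simp: var_dvd_mult_iff)
qed

text \<open>
  Having only the trivial idempotents is invariant under ring isomorphisms; here it is phrased for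
  representatives of the cosets.
\<close>

lemma fibers_isomorphic_idempotents:
  assumes p: "p \<in> cpolys n" and q: "q \<in> cpolys n"
    and iso: "fibers_isomorphic n p c q d"
    and idem: "\<And>f. f \<in> cpolys n \<Longrightarrow> p - cpoly_const c dvd f * (f - 1) \<Longrightarrow>
       p - cpoly_const c dvd f \<or> p - cpoly_const c dvd f - 1"
    and e: "e \<in> cpolys n" and ee: "q - cpoly_const d dvd e * (e - 1)"
  shows "q - cpoly_const d dvd e \<or> q - cpoly_const d dvd e - 1"
proof -
  let ?R = "fiber_ring n p c" and ?S = "fiber_ring n q d"
  let ?P = "fiber_coset n p c" and ?Q = "fiber_coset n q d"
  interpret P: ring_hom_ring "cpoly_ring n" ?R ?P by (rule fiber_coset_hom[OF p])
  interpret Q: ring_hom_ring "cpoly_ring n" ?S ?Q by (rule fiber_coset_hom[OF q])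
  obtain h where "h \<in> ring_iso ?R ?S" using iso by (auto simp: fibers_isomorphic_def)
  then have hom: "ring_hom_ring ?R ?S h" and bij: "bij_betw h (carrier ?R) (carrier ?S)"
    by (auto simp: ring_iso_def intro: ring_hom_ringI2 P.S.ring_axioms Q.S.ring_axioms)
  interpret h: ring_hom_ring ?R ?S h by (rule hom)
  have "?Q e \<in> h ` carrier ?R"
    using e bij_betw_imp_surj_on[OF bij] by (simp add: carrier_fiber_ring)
  then obtain f where f: "f \<in> cpolys n" and hf: "h (?P f) = ?Q e"
    unfolding carrier_fiber_ring by force
  have Pc: "?P g \<in> carrier ?R" if "g \<in> cpolys n" for g
    using that by (simp add: carrier_fiber_ring)
  have "h (?P (f * f)) = ?Q (e * e)"
    using P.hom_mult[of f f] Q.hom_mult[of e e] f e hf Pc[OF f] by simp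
  also have "\<dots> = h (?P f)"
    using q e ee by (simp add: hf fiber_coset_eq_iff cpolys_intros algebra_simps)
  finally have "?P (f * f) = ?P f"
    using bij Pc f by (auto simp: bij_betw_def inj_on_def cpolys_intros)
  then have "p - cpoly_const c dvd f * (f - 1)"
    using p f by (simp add: fiber_coset_eq_iff cpolys_intros algebra_simps)
  then have "?P f = ?P 0 \<or> ?P f = ?P 1"
    using idem[OF f] p f by (simp add: fiber_coset_eq_iff cpolys_intros)
  then have "?Q e = ?Q 0 \<or> ?Q e = ?Q 1"
    using hf P.hom_zero P.hom_one Q.hom_zero Q.hom_one h.hom_zero h.hom_one by auto
  then show ?thesis using q e by (simp add: fiber_coset_eq_iff cpolys_intros)
qed

section \<open>Zeros of gradients\<close>

lemma cpoly_pderiv_single: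
  "cpoly_pderiv i (Poly_Mapping.single m c) =
     Poly_Mapping.single (m - Poly_Mapping.single i 1) (of_nat (Poly_Mapping.lookup m i) * c)"
  unfolding cpoly_pderiv_def
  by (rule sum_keys_single[where f = "\<lambda>m c. Poly_Mapping.single (m - Poly_Mapping.single i 1)
        (of_nat (Poly_Mapping.lookup m i) * c)"]) simp

lemma cpoly_pderiv_add: "cpoly_pderiv i (p + q) = cpoly_pderiv i p + cpoly_pderiv i q"
  unfolding cpoly_pderiv_def
  by (rule setsum_keys_plus_distrib) (simp_all add: single_add distrib_left)

lemma cpoly_eval_single:
  "cpoly_eval x (Poly_Mapping.single m c) =
     c * (\<Prod>i\<in>Poly_Mapping.keys m. x i ^ Poly_Mapping.lookup m i)"
  unfolding cpoly_eval_def
  by (rule sum_keys_single[where f = "\<lambda>m c. c *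
        (\<Prod>i\<in>Poly_Mapping.keys m. x i ^ Poly_Mapping.lookup m i)"]) simp

lemma cpoly_eval_add: "cpoly_eval x (p + q) = cpoly_eval x p + cpoly_eval x q"
  unfolding cpoly_eval_def
  by (rule setsum_keys_plus_distrib) (simp_all add: distrib_right)

lemma cpoly_pderiv_const [simp]: "cpoly_pderiv i (cpoly_const c) = 0"
  by (simp add: cpoly_const_def cpoly_pderiv_single)

lemma cpoly_eval_const [simp]: "cpoly_eval x (cpoly_const c) = c"
  by (simp add: cpoly_const_def cpoly_eval_single)

lemma cpoly_eval_0 [simp]: "cpoly_eval x 0 = 0"
  by (simp add: cpoly_eval_def)

lemma cpoly_pderiv_var: "cpoly_pderiv i (cpoly_var j) = (if i = j then 1 else 0)"
  by (auto simp: cpoly_var_def cpoly_pderiv_single lookup_single when_def)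

lemma cpoly_pderiv_mult:
  "cpoly_pderiv i (p * q) = cpoly_pderiv i p * q + p * cpoly_pderiv i q"
proof (induction p rule: cpoly_induct)
  case (single m c)
  show ?case
  proof (induction q rule: cpoly_induct)
    case (single m' c')
    let ?e = "Poly_Mapping.single i (1::nat)"
    \<comment> \<open>The truncated subtraction is exact when \<open>i\<close> occurs in \<open>a\<close>; otherwise the term that
        contains it has coefficient \<open>0\<close>.\<close>
    have shift: "a - ?e + b = a + b - ?e" if "Poly_Mapping.lookup a i \<noteq> 0"
      for a b :: "nat \<Rightarrow>\<^sub>0 nat"
      using that
      by (intro poly_mapping_eqI) (auto simp: lookup_add lookup_minus lookup_single when_def)
    show ?case
      using shift[of m m'] shift[of m' m]
      by (cases "Poly_Mapping.lookup m i = 0"; cases "Poly_Mapping.lookup m' i = 0")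
         (simp_all add: cpoly_pderiv_single mult_single lookup_add algebra_simps
            flip: single_add)
  next
    case (add q r)
    then show ?case by (simp add: distrib_left cpoly_pderiv_add add_ac)
  qed
next
  case (add p r)
  then show ?case by (simp add: distrib_right cpoly_pderiv_add add_ac)
qed

text \<open>Evaluation is the substitution of constants, which makes it multiplicative.\<close>

lemma cpoly_const_eval: "cpoly_const (cpoly_eval x p) = cpoly_subst (\<lambda>i. cpoly_const (x i)) p"
proof -
  have power: "cpoly_const (a ^ k) = cpoly_const a ^ k" for a k
    by (induction k) (simp_all add: cpoly_const_mult)
  have prod: "cpoly_const (prod g A) = (\<Prod>i\<in>A. cpoly_const (g i))" for A :: "nat set" and g
    by (induction A rule: infinite_finite_induct) (simp_all add: cpoly_const_mult)
  show ?thesis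
    by (induction p rule: cpoly_induct)
       (simp_all add: cpoly_eval_add cpoly_const_add cpoly_subst_add cpoly_eval_single
          cpoly_subst_single cpoly_const_mult monom_subst_def prod power)
qed

lemma cpoly_eval_mult: "cpoly_eval x (p * q) = cpoly_eval x p * cpoly_eval x q"
  by (simp add: cpoly_const_eval cpoly_subst_mult cpoly_const_mult flip: cpoly_const_inject)

lemma cpoly_eval_var [simp]: "cpoly_eval x (cpoly_var i) = x i"
  by (simp add: cpoly_const_eval flip: cpoly_const_inject)

lemma cpoly_eval_1 [simp]: "cpoly_eval x 1 = 1"
  using cpoly_eval_const[of x 1] by simp

section \<open>The two hypersurfaces\<close>

definition hyperbola :: cpoly where
  "hyperbola = cpoly_var 0 * cpoly_var 1 + cpoly_const (- 1)"

definition twisted_hyperbola :: cpoly where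
  "twisted_hyperbola = cpoly_var 0 * cpoly_var 0 * cpoly_var 1 + cpoly_var 0 + cpoly_const (- 1)"

lemma hyperbola_in_cpolys: "n \<ge> 2 \<Longrightarrow> hyperbola \<in> cpolys n"
  and twisted_hyperbola_in_cpolys: "n \<ge> 2 \<Longrightarrow> twisted_hyperbola \<in> cpolys n"
  by (auto simp: hyperbola_def twisted_hyperbola_def intro!: cpolys_intros)

text \<open>
  The cofactors below are the explicit witnesses that the substitutions respect the two ideals and
  are inverse to each other modulo them.
\<close>

lemma zero_fibers_isomorphic:
  assumes "n \<ge> 2"
  shows "fibers_isomorphic n hyperbola 0 twisted_hyperbola 0"
proof -
  let ?x = "cpoly_var 0" and ?y = "cpoly_var 1"
  define s where "s = cpoly_var(1 := ?x * ?y + 1)"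
  define t where "t = cpoly_var(1 := (1 - ?x) * ?y * ?y)"
  have const: "cpoly_const (- 1) = - 1" by (simp add: cpoly_const_minus)
  show ?thesis
  proof (rule fibers_isomorphicI)
    show "hyperbola \<in> cpolys n" "twisted_hyperbola \<in> cpolys n"
      using assms by (rule hyperbola_in_cpolys twisted_hyperbola_in_cpolys)+
    show "s i \<in> cpolys n" "t i \<in> cpolys n" if "i < n" for i
      using that assms by (auto simp: s_def t_def intro!: cpolys_intros)
    have "cpoly_subst s hyperbola = twisted_hyperbola"
      by (simp add: hyperbola_def twisted_hyperbola_def cpoly_subst_simps s_def algebra_simps)
    then show "twisted_hyperbola - cpoly_const 0 dvd cpoly_subst s (hyperbola - cpoly_const 0)"
      by simp
    have "cpoly_subst t twisted_hyperbola = hyperbola * ((1 - ?x) * (?x * ?y + 1))"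
      by (simp add: hyperbola_def twisted_hyperbola_def cpoly_subst_simps t_def const algebra_simps)
    then show "hyperbola - cpoly_const 0 dvd cpoly_subst t (twisted_hyperbola - cpoly_const 0)"
      by simp
    have "cpoly_subst t (s 1) - ?y = hyperbola * ((1 - ?x) * ?y - 1)"
      by (simp add: hyperbola_def cpoly_subst_simps s_def t_def const algebra_simps)
    then have "hyperbola dvd cpoly_subst t (s 1) - ?y" by simp
    then show "hyperbola - cpoly_const 0 dvd cpoly_subst t (s i) - cpoly_var i" for i
      by (cases "i = 1") (simp_all add: s_def t_def)
    have "cpoly_subst s (t 1) - ?y = twisted_hyperbola * (?y - (?x * ?y + 1))"
      by (simp add: twisted_hyperbola_def cpoly_subst_simps s_def t_def const algebra_simps)
    then have "twisted_hyperbola dvd cpoly_subst s (t 1) - ?y" by simp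
    then show "twisted_hyperbola - cpoly_const 0 dvd cpoly_subst s (t i) - cpoly_var i" for i
      by (cases "i = 1") (simp_all add: s_def t_def)
  qed
qed

lemma origin_in_grad_zeros_hyperbola:
  assumes "n \<ge> 2"
  shows "(\<lambda>i\<in>{..<n}. 0) \<in> grad_zeros n hyperbola"
  using assms
  by (auto simp: grad_zeros_def affine_space_def hyperbola_def cpoly_pderiv_add cpoly_pderiv_mult
      cpoly_pderiv_var cpoly_eval_add cpoly_eval_mult restrict_def PiE_def extensional_def)

lemma grad_zeros_twisted_hyperbola:
  assumes "n \<ge> 2"
  shows "grad_zeros n twisted_hyperbola = {}"
proof (rule equals0I)
  fix x assume x: "x \<in> grad_zeros n twisted_hyperbola"
  have "cpoly_eval x (cpoly_pderiv 1 twisted_hyperbola) = x 0 * x 0"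
    by (simp add: twisted_hyperbola_def cpoly_pderiv_add cpoly_pderiv_mult cpoly_pderiv_var
        cpoly_eval_add cpoly_eval_mult)
  moreover have "cpoly_eval x (cpoly_pderiv 0 twisted_hyperbola) = 2 * x 0 * x 1 + 1"
    using cpoly_eval_add[of x 1 1]
    by (simp add: twisted_hyperbola_def cpoly_pderiv_add cpoly_pderiv_mult cpoly_pderiv_var
        cpoly_eval_add cpoly_eval_mult)
  ultimately show False using x assms by (auto simp: grad_zeros_def)
qed

lemma fibers_not_isomorphic:
  assumes "n \<ge> 2"
  shows "\<not> fibers_isomorphic n hyperbola (- 1) twisted_hyperbola (- 1)"
proof
  let ?x = "cpoly_var 0" and ?y = "cpoly_var 1"
  assume iso: "fibers_isomorphic n hyperbola (- 1) twisted_hyperbola (- 1)"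
  have p: "hyperbola - cpoly_const (- 1) = ?x * ?y"
    by (simp add: hyperbola_def)
  have q: "twisted_hyperbola - cpoly_const (- 1) = ?x * (?x * ?y + 1)"
    by (simp add: twisted_hyperbola_def algebra_simps)
  let ?e = "?x * ?y + 1"
  have "?x * (?x * ?y + 1) dvd ?e \<or> ?x * (?x * ?y + 1) dvd ?e - 1"
  proof (rule fibers_isomorphic_idempotents[OF _ _ iso, of ?e, unfolded p q])
    show "hyperbola \<in> cpolys n" "twisted_hyperbola \<in> cpolys n"
      using assms by (rule hyperbola_in_cpolys twisted_hyperbola_in_cpolys)+
    show "?e \<in> cpolys n" using assms by (auto intro!: cpolys_intros)
    show "?x * ?y dvd f \<or> ?x * ?y dvd f - 1" if "?x * ?y dvd f * (f - 1)" for f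
      using that by (intro idempotent_mod_var_mult_var) auto
    show "?x * (?x * ?y + 1) dvd ?e * (?e - 1)" by (simp add: mult.left_commute[of ?e])
  qed
  \<comment> \<open>The idempotent is nontrivial: it is \<open>1\<close> at the origin and \<open>0\<close> at \<open>(1, -1, ..., -1)\<close>,
      and both points lie on the fibre.\<close>
  moreover have "\<not> ?x * (?x * ?y + 1) dvd ?e"
  proof
    assume "?x * (?x * ?y + 1) dvd ?e"
    then obtain g where "?e = ?x * (?x * ?y + 1) * g" by blast
    from arg_cong[OF this, of "cpoly_eval (\<lambda>_. 0)"] show False
      by (simp add: cpoly_eval_add cpoly_eval_mult)
  qed
  moreover have "\<not> ?x * (?x * ?y + 1) dvd ?e - 1"
  proof
    assume "?x * (?x * ?y + 1) dvd ?e - 1"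
    then obtain g where "?x * ?y = ?x * (?x * ?y + 1) * g" by auto
    from arg_cong[OF this, of "cpoly_eval (\<lambda>i. if i = 0 then 1 else - 1)"] show False
      by (simp add: cpoly_eval_add cpoly_eval_mult)
  qed
  ultimately show False by blast
qed

theorem mainTheorem5:
  fixes n :: nat
  assumes "n \<ge> 2"
  shows "\<exists>p \<in> cpolys n. \<exists>q \<in> cpolys n.
           fibers_isomorphic n p 0 q 0 \<and>
           num_elems (grad_zeros n p) \<noteq> num_elems (grad_zeros n q) \<and>
           (\<exists>c. \<not> fibers_isomorphic n p c q c)"
proof (intro bexI conjI exI)
  show "fibers_isomorphic n hyperbola 0 twisted_hyperbola 0"
    using assms by (rule zero_fibers_isomorphic)
  show "\<not> fibers_isomorphic n hyperbola (- 1) twisted_hyperbola (- 1)"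
    using assms by (rule fibers_not_isomorphic)
  have "num_elems (grad_zeros n twisted_hyperbola) = 0"
    using assms by (simp add: grad_zeros_twisted_hyperbola num_elems_def zero_enat_def)
  moreover have "num_elems (grad_zeros n hyperbola) \<noteq> 0"
    using origin_in_grad_zeros_hyperbola[OF assms] by (auto simp: num_elems_def zero_enat_def card_eq_0_iff)
  ultimately show "num_elems (grad_zeros n hyperbola) \<noteq> num_elems (grad_zeros n twisted_hyperbola)"
    by simp
  show "hyperbola \<in> cpolys n" "twisted_hyperbola \<in> cpolys n"
    using assms by (rule hyperbola_in_cpolys twisted_hyperbola_in_cpolys)+
qed

end
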